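(* For every integer $n>0$, \[ K^{+}([2n])=-T_{n-1,n},\qquad K^{+}([-2n])=-T_{n,n+1}, \] and $K^{+}([0])$ is the unknot.
   Context: For a rational number $p/q$ with $p$ even and $q$ odd, the two-bridge link $N(p/q)$ is the numerator closure of the rational tangle $p/q$, with the convention that for $n>0$ the link $N(2n/1)$ is the torus link $T_{2,2n}$ formed by $2n$ right-handed half-twists, $N(-2n/1)$ is its mirror image, and $N(0)$ is the two-component unlink. Both components are unknotted. $K^{\pm}(p/q)\subset S^3$ is the knot obtained by blowing down one (the upper) component with framing $\pm1$, i.e. the image of the other component after $\pm1$-surgery on that unknotted component. $K^{\pm}([a])$ denotes $K^{\pm}(a/1)$. $T_{p,q}$ is the positive torus knot ($T_{0,1}$ and $T_{1,2}$ being unknots), $-K$ denotes the mirror image of $K$, and equality means isotopy of knots in $S^3$. *)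

theory Defs
  imports "HOL-Analysis.Analysis"
begin

text \<open>
  The three-sphere is the unit sphere of \<open>\<complex>\<^sup>2\<close>, oriented as the boundary of the unit ball, so that
  the curves \<open>w \<mapsto> (w\<^sup>p, w\<^sup>q)\<close> with \<open>p, q > 0\<close> are the positive torus knots.  Points of
  \<open>S\<^sup>3\<close> are written \<open>sgn (a, b)\<close>, the radial projection of \<open>(a, b) \<noteq> 0\<close>.
  Knots are unoriented and are given as subsets of \<open>S\<^sup>3\<close>.
\<close>

type_synonym c2 = "complex \<times> complex"

abbreviation S3 :: "c2 set" where
  "S3 \<equiv> sphere 0 1"

abbreviation S1 :: "complex set" where
  "S1 \<equiv> sphere 0 1"

definition isotopic_to_id :: "(c2 \<Rightarrow> c2) \<Rightarrow> bool" where
  "isotopic_to_id f \<longleftrightarrow>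
     homotopic_with_canon (\<lambda>f. \<exists>g. homeomorphism S3 S3 f g) S3 S3 id f"

definition isotopic :: "c2 set \<Rightarrow> c2 set \<Rightarrow> bool" where
  "isotopic K J \<longleftrightarrow> (\<exists>f. isotopic_to_id f \<and> f ` K = J)"

definition torus_knot :: "nat \<Rightarrow> nat \<Rightarrow> c2 set" where
  "torus_knot p q = (\<lambda>w. sgn (w ^ p, w ^ q)) ` S1"

definition mirror :: "c2 set \<Rightarrow> c2 set" where
  "mirror K = (\<lambda>(z1, z2). (z1, cnj z2)) ` K"

definition unknot :: "c2 set" where
  "unknot = {0} \<times> S1"


section \<open>Two-bridge links\<close>

text \<open>
  The tangle ball is the half \<open>Re z1 \<ge> 0\<close> of \<open>S\<^sup>3\<close>.  Its boundary carries the pillowcase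
  \<open>\<real>\<^sup>2 / \<langle>\<pi>-rotations about the points of \<int>\<^sup>2\<rangle>\<close>, embedded by
  \<open>(s, t) \<mapsto> (Im z1, Re z2, Im z2) = (cos (\<pi>s), cos (\<pi>t), - sin (\<pi>s) sin (\<pi>t))\<close>
  followed by radial projection; \<open>Im z1\<close> is the horizontal and \<open>Re z2\<close> the vertical direction of
  the tangle diagram, and the four corners are \<open>(\<plusminus>\<i>, \<plusminus>1)\<close>.  The rational tangle \<open>p/q\<close> consists
  of the two arcs that are the images of the segments of slope \<open>p/q\<close> from \<open>(0, 0)\<close> to \<open>(q, p)\<close> and
  from \<open>(0, 1)\<close> to \<open>(q, p + 1)\<close>, with interiors pushed into the ball (the \<open>sin (\<pi>x)\<close> below).
  The numerator closure adds, in the other half, the two horizontal arcs joining \<open>(\<i>, \<plusminus>1)\<close> to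
  \<open>(-\<i>, \<plusminus>1)\<close>.  The sign of the last pillowcase coordinate makes positive slopes
  right-handed: for \<open>q = 1\<close>, \<open>p = 2n\<close> the coordinate \<open>z1\<close> runs once around the circle while
  \<open>z2\<close> winds \<open>n\<close> times around \<open>0\<close> in the same sense, giving two curves isotopic to
  \<open>w \<mapsto> (w, \<plusminus> w\<^sup>n)\<close>.
\<close>

definition tangle_arc :: "int \<Rightarrow> int \<Rightarrow> real \<Rightarrow> c2 set" where
  "tangle_arc p q c =
     (\<lambda>x. let s = q * x; t = p * x + c in
        sgn (Complex (sin (pi * x)) (cos (pi * s)),
             Complex (cos (pi * t)) (- sin (pi * s) * sin (pi * t)))) ` {0..1}"

definition closing_arc :: "complex \<Rightarrow> c2 set" where
  "closing_arc b = (\<lambda>x. sgn (Complex (- sin (pi * x)) (cos (pi * x)), b)) ` {0..1::real}"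

text \<open>For a reduced fraction \<open>p/q\<close> with \<open>p\<close> even (and hence \<open>q\<close> odd) each tangle arc joins the ends
  of one closing arc, so the following are the two components of the link \<open>N(p/q)\<close>.\<close>

definition upper_component :: "rat \<Rightarrow> c2 set" where
  "upper_component r = (case quotient_of r of (p, q) \<Rightarrow> tangle_arc p q 0 \<union> closing_arc 1)"

definition lower_component :: "rat \<Rightarrow> c2 set" where
  "lower_component r = (case quotient_of r of (p, q) \<Rightarrow> tangle_arc p q 1 \<union> closing_arc (- 1))"


section \<open>Surgery on an unknotted component\<close>

abbreviation solid_torus :: "c2 set" where
  "solid_torus \<equiv> S1 \<times> cball 0 1"

text \<open>
  \<open>\<phi>\<close> is an orientation-preserving tubular neighbourhood of the unknotted circle \<open>U\<close>, with
  core \<open>w \<mapsto> \<phi> (w, 0)\<close>, meridian \<open>\<mu> = \<phi> (1, \<cdot>)\<close> and preferred (0-framed) longitude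
  \<open>\<lambda> = \<phi> (\<cdot>, 1)\<close>: up to an ambient isotopy it is the neighbourhood \<open>(w, v) \<mapsto> sgn (v, w)\<close> of the
  standard unknot, for which \<open>\<lambda>\<close> bounds the disc \<open>arg z1 = 0\<close> and the linking number of core and
  meridian is \<open>1\<close>.
\<close>

definition preferred_nbhd :: "c2 set \<Rightarrow> (c2 \<Rightarrow> c2) \<Rightarrow> bool" where
  "preferred_nbhd U \<phi> \<longleftrightarrow>
     (\<exists>f. isotopic_to_id f \<and> f ` unknot = U \<and> (\<forall>w\<in>S1. \<forall>v\<in>cball 0 1. \<phi> (w, v) = f (sgn (v, w))))"

definition exterior :: "(c2 \<Rightarrow> c2) \<Rightarrow> c2 set" where
  "exterior \<phi> = S3 - \<phi> ` (S1 \<times> ball 0 1)"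

text \<open>An embedding of a connected piece of \<open>S\<^sup>3\<close> preserves orientation if it does so near some point.\<close>

definition orientation_preserving_on :: "c2 set \<Rightarrow> (c2 \<Rightarrow> c2) \<Rightarrow> bool" where
  "orientation_preserving_on E h \<longleftrightarrow>
     (\<exists>W g. openin (top_of_set S3) W \<and> W \<noteq> {} \<and> W \<subseteq> E \<and> isotopic_to_id g \<and> (\<forall>x\<in>W. h x = g x))"

text \<open>
  Surgery with integral framing \<open>\<epsilon>\<close> removes the interior of the neighbourhood \<open>\<phi>\<close> and glues in a
  new solid torus whose meridians \<open>v \<mapsto> (u, v)\<close> are attached along parallels of the curve
  \<open>\<lambda> + \<epsilon>\<mu>\<close>, i.e. of \<open>v \<mapsto> \<phi> (v, v\<^sup>\<epsilon>)\<close>.  An orientation-preserving homeomorphism from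
  the surgered manifold to \<open>S\<^sup>3\<close> is the same as a pair of embeddings, \<open>h\<close> of the exterior and \<open>\<psi>\<close>
  of the new solid torus, that agree under the gluing, otherwise have disjoint images, and
  together cover \<open>S\<^sup>3\<close>.
\<close>

definition surgery_is_sphere :: "int \<Rightarrow> (c2 \<Rightarrow> c2) \<Rightarrow> (c2 \<Rightarrow> c2) \<Rightarrow> (c2 \<Rightarrow> c2) \<Rightarrow> bool" where
  "surgery_is_sphere \<epsilon> \<phi> h \<psi> \<longleftrightarrow>
     continuous_on (exterior \<phi>) h \<and> inj_on h (exterior \<phi>) \<and>
     orientation_preserving_on (exterior \<phi>) h \<and>
     continuous_on solid_torus \<psi> \<and> inj_on \<psi> solid_torus \<and>
     (\<forall>u\<in>S1. \<forall>v\<in>S1. \<psi> (u, v) = h (\<phi> (v, u * v powi \<epsilon>))) \<and>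
     h ` exterior \<phi> \<inter> \<psi> ` (S1 \<times> ball 0 1) = {} \<and>
     h ` exterior \<phi> \<union> \<psi> ` solid_torus = S3"

text \<open>The isotopy class of the image of \<open>K\<close> after blowing down \<open>U\<close> with framing \<open>\<epsilon>\<close>.\<close>

definition blow_down :: "int \<Rightarrow> c2 set \<Rightarrow> c2 set \<Rightarrow> c2 set set" where
  "blow_down \<epsilon> U K =
     {J. \<exists>\<phi> h \<psi>. preferred_nbhd U \<phi> \<and> K \<inter> \<phi> ` solid_torus = {} \<and>
           surgery_is_sphere \<epsilon> \<phi> h \<psi> \<and> isotopic (h ` K) J}"

text \<open>
  The knot types \<open>K\<^sup>+(r)\<close> and \<open>K\<^sup>-(r)\<close>.  As isotopy classes they are sets of knots, so that
  ``\<open>K\<^sup>+(r) = J\<close>'' for a knot \<open>J\<close> is rendered \<open>J \<in> K_plus r\<close>.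
\<close>

definition K_plus :: "rat \<Rightarrow> c2 set set" where
  "K_plus r = blow_down 1 (upper_component r) (lower_component r)"

definition K_minus :: "rat \<Rightarrow> c2 set set" where
  "K_minus r = blow_down (- 1) (upper_component r) (lower_component r)"

end

theory Submission
  imports Defs
begin

text \<open>
  Over the unit circle of the first coordinate, the link \<open>N(2m/1)\<close> consists of the graphs of two
  opposite functions \<open>\<plusminus>f\<close>, where \<open>f\<close> has no zeros and winds \<open>m\<close> times around \<open>0\<close>
  (\<open>strand_winding\<close>).  Rescaling the first coordinate and rephasing the second therefore
  straighten the link to the pair \<open>w \<mapsto> (w, \<plusminus>w\<^sup>m)\<close>.  The shear that subtracts
  \<open>w\<^sup>m\<close> from the second coordinate turns this pair into \<open>w \<mapsto> (w, 0)\<close> and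
  \<open>w \<mapsto> (w, -2w\<^sup>m)\<close>.  After a quarter turn that exchanges the coordinates, the upper component
  is the core \<open>z1 = 0\<close> of the standard solid torus \<open>|z1| \<le> |z2|\<close>, and the lower component is
  \<open>w \<mapsto> (2w\<^sup>m, w)\<close>, an \<open>m\<close>-strand closed braid in the complementary solid torus
  \<open>|z1| \<ge> |z2|\<close> (\<open>straighten_graph_link\<close>).

  Blowing down \<open>z1 = 0\<close> with framing \<open>+1\<close> puts one full left-handed twist into the complementary
  solid torus: the map \<open>(z1, z2) \<mapsto> (z1, z2 |z1| / z1)\<close> sends the curve
  \<open>\<lambda> + \<mu>\<close>, along which the new meridian disc is attached, to a meridian of
  \<open>|z1| \<le> |z2|\<close> (\<open>blow_down_plus_one\<close>).  It sends the lower component to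
  \<open>w \<mapsto> (2w\<^sup>m, w\<^bsup>1-m\<^esup>)\<close>.  For \<open>m = n\<close> this is, up to exchanging coordinates,
  \<open>-T(n-1,n)\<close>; for \<open>m = -n\<close> it is \<open>-T(n,n+1)\<close>; for \<open>m = 0\<close> it is a circle that a shear moves
  onto the unknot.

  All ambient isotopies are assembled from four explicit families: rotations, shears and
  rescalings, which are positively homogeneous maps of \<open>\<complex>\<^sup>2\<close> and so act on the rays that form
  \<open>S\<^sup>3\<close> (\<open>isotopic_to_id_homogeneous\<close>), and twists, which change the phase of the second coordinate
  by an angle that depends on the first.
\<close>

section \<open>Isotopies of the three-sphere\<close>

text \<open>
  Compactness of \<open>S\<^sup>3\<close> makes continuous bijections homeomorphisms, so that an isotopy can be
  given without the inverses.
\<close>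

lemma isotopic_to_id_iff:
  "isotopic_to_id f \<longleftrightarrow>
     (\<exists>F. continuous_on ({0..1::real} \<times> S3) (\<lambda>(t, x). F t x) \<and>
          (\<forall>t\<in>{0..1}. bij_betw (F t) S3 S3) \<and> (\<forall>x\<in>S3. F 0 x = x \<and> F 1 x = f x))"
proof -
  have "isotopic_to_id f \<longleftrightarrow>
     (\<exists>h. continuous_map (prod_topology (top_of_set {0..1::real}) (top_of_set S3)) (top_of_set S3) h \<and>
          (\<forall>x\<in>S3. h (0, x) = id x) \<and> (\<forall>x\<in>S3. h (1, x) = f x) \<and>
          (\<forall>t\<in>{0..1}. \<exists>g. homeomorphism S3 S3 (\<lambda>x. h (t, x)) g))" (is "_ \<longleftrightarrow> (\<exists>h. ?P h)")
    unfolding isotopic_to_id_def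
  proof (subst homotopic_with)
    show "(\<exists>g'. homeomorphism S3 S3 h g') = (\<exists>g'. homeomorphism S3 S3 k g')"
      if "\<And>x. x \<in> topspace (top_of_set S3) \<Longrightarrow> h x = k x" for h k :: "c2 \<Rightarrow> c2"
    proof -
      have "homeomorphism S3 S3 k' g'" if "homeomorphism S3 S3 h' g'" "\<And>x. x \<in> S3 \<Longrightarrow> h' x = k' x"
        for h' k' :: "c2 \<Rightarrow> c2" and g'
        by (rule homeomorphism_cong[OF that(1) refl refl]) (use that(2) in simp_all)
      from this[of h _ k] this[of k _ h] that show ?thesis
        unfolding topspace_euclidean_subtopology by metis
    qed
  qed (simp only: topspace_euclidean_subtopology)
  also have "\<dots> \<longleftrightarrow> (\<exists>F. continuous_on ({0..1::real} \<times> S3) (\<lambda>(t, x). F t x) \<and>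
          (\<forall>t\<in>{0..1}. bij_betw (F t) S3 S3) \<and> (\<forall>x\<in>S3. F 0 x = x \<and> F 1 x = f x))" (is "_ \<longleftrightarrow> (\<exists>F. ?Q F)")
  proof
    assume "\<exists>h. ?P h"
    then obtain h where h: "?P h" by blast
    have "bij_betw (\<lambda>x. h (t, x)) S3 S3" if "t \<in> {0..1}" for t
      using h that unfolding homeomorphism_def bij_betw_def inj_on_def by metis
    then have "?Q (\<lambda>t x. h (t, x))"
      using h by (simp add: case_prod_unfold del: mem_sphere_0)
    then show "\<exists>F. ?Q F" by (rule exI[of _ "\<lambda>t x. h (t, x)"])
  next
    assume "\<exists>F. ?Q F"
    then obtain F where F: "?Q F" by blast
    have "\<exists>g. homeomorphism S3 S3 (F t) g" if t: "t \<in> {0..1}" for t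
    proof -
      have "continuous_on S3 (\<lambda>x. (\<lambda>(t, x). F t x) (t, x))"
        by (rule continuous_on_compose2[of "{0..1} \<times> S3"]) (use F t in \<open>auto intro!: continuous_intros\<close>)
      then have "continuous_on S3 (F t)" by simp
      moreover have "F t ` S3 = S3" "inj_on (F t) S3"
        using F t unfolding bij_betw_def by blast+
      ultimately show ?thesis by (rule homeomorphism_compact[OF compact_sphere])
    qed
    moreover have "F t x \<in> S3" if "t \<in> {0..1}" "x \<in> S3" for t x
      using F that bij_betw_apply by metis
    ultimately have "?P (\<lambda>(t, x). F t x)"
      using F by (simp add: case_prod_unfold Pi_iff del: mem_sphere_0)
    then show "\<exists>h. ?P h" by (rule exI[of _ "\<lambda>(t, x). F t x"])
  qed
  finally show ?thesis .
qed

lemma isotopic_to_id_cong: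
  assumes "\<And>x. x \<in> S3 \<Longrightarrow> f x = g x"
  shows "isotopic_to_id f \<longleftrightarrow> isotopic_to_id g"
proof -
  have "(\<forall>x\<in>S3. F 0 x = x \<and> F 1 x = f x) \<longleftrightarrow> (\<forall>x\<in>S3. F 0 x = x \<and> F 1 x = g x)" for F :: "real \<Rightarrow> c2 \<Rightarrow> c2"
    using assms by metis
  then show ?thesis unfolding isotopic_to_id_iff by presburger
qed

lemma isotopic_to_id_homeomorphism:
  assumes "isotopic_to_id f"
  shows "continuous_on S3 f" "bij_betw f S3 S3"
proof -
  obtain F where F: "continuous_on ({0..1::real} \<times> S3) (\<lambda>(t, x). F t x)"
      "\<forall>t\<in>{0..1}. bij_betw (F t) S3 S3" "\<forall>x\<in>S3. F 0 x = x \<and> F 1 x = f x"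
    using assms unfolding isotopic_to_id_iff by blast
  have "continuous_on S3 (\<lambda>x. (\<lambda>(t, x). F t x) (1, x))"
    by (rule continuous_on_compose2[OF F(1)]) (auto intro!: continuous_intros)
  then show "continuous_on S3 f"
    by (rule continuous_on_eq) (use F in auto)
  have "bij_betw (F 1) S3 S3" using F by simp
  then show "bij_betw f S3 S3"
    by (rule iffD1[OF bij_betw_cong, rotated]) (use F(3) in simp)
qed

lemma isotopic_to_id_comp:
  assumes "isotopic_to_id f" "isotopic_to_id g"
  shows "isotopic_to_id (\<lambda>x. g (f x))"
proof -
  obtain F where F: "continuous_on ({0..1::real} \<times> S3) (\<lambda>(t, x). F t x)"
      "\<forall>t\<in>{0..1}. bij_betw (F t) S3 S3" "\<forall>x\<in>S3. F 0 x = x \<and> F 1 x = f x"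
    using assms unfolding isotopic_to_id_iff by blast
  obtain G where G: "continuous_on ({0..1::real} \<times> S3) (\<lambda>(t, x). G t x)"
      "\<forall>t\<in>{0..1}. bij_betw (G t) S3 S3" "\<forall>x\<in>S3. G 0 x = x \<and> G 1 x = g x"
    using assms unfolding isotopic_to_id_iff by blast
  have FS: "F t x \<in> S3" if "t \<in> {0..1}" "x \<in> S3" for t x
    using F that by (auto dest!: bspec[of _ _ t] bij_betw_apply)
  have "continuous_on ({0..1} \<times> S3) (\<lambda>p. (\<lambda>(t, x). G t x) (fst p, (\<lambda>(t, x). F t x) p))"
    by (rule continuous_on_compose2[OF G(1)])
       (use F FS in \<open>auto intro!: continuous_intros simp del: mem_sphere_0 simp: case_prod_unfold\<close>)
  then have "continuous_on ({0..1} \<times> S3) (\<lambda>(t, x). G t (F t x))"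
    by (simp add: case_prod_unfold)
  moreover have "bij_betw (\<lambda>x. G t (F t x)) S3 S3" if "t \<in> {0..1}" for t
    using bij_betw_trans[of "F t" S3 S3 "G t" S3] F G that by (auto simp: o_def)
  moreover have "f x \<in> S3" if "x \<in> S3" for x
    using F(3) FS[of 1] that by auto
  ultimately show ?thesis
    unfolding isotopic_to_id_iff using F(3) G(3)
    by (intro exI[of _ "\<lambda>t x. G t (F t x)"]) (auto simp del: mem_sphere_0)
qed

text \<open>Running the isotopy \<open>F\<close> from \<open>id\<close> to \<open>f\<close> backwards, after \<open>f\<inverse>\<close>.\<close>

lemma isotopic_to_id_inverse:
  assumes "isotopic_to_id f"
  shows "isotopic_to_id (the_inv_into S3 f)"
proof -
  let ?g = "the_inv_into S3 f"
  obtain F where F: "continuous_on ({0..1::real} \<times> S3) (\<lambda>(t, x). F t x)"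
      "\<forall>t\<in>{0..1}. bij_betw (F t) S3 S3" "\<forall>x\<in>S3. F 0 x = x \<and> F 1 x = f x"
    using assms unfolding isotopic_to_id_iff by blast
  note f = isotopic_to_id_homeomorphism[OF assms]
  have g: "bij_betw ?g S3 S3" by (rule bij_betw_the_inv_into[OF f(2)])
  have gS: "?g x \<in> S3" if "x \<in> S3" for x using bij_betw_apply[OF g that] .
  have gf: "f (?g x) = x" if "x \<in> S3" for x
    using f(2) that by (auto simp: bij_betw_def intro!: f_the_inv_into_f)
  have "continuous_on (f ` S3) ?g"
    using f by (intro continuous_on_inv) (auto simp: bij_betw_def the_inv_into_f_f)
  then have g_cont: "continuous_on S3 ?g" using f(2) by (simp add: bij_betw_def)
  have "continuous_on ({0..1} \<times> S3) (\<lambda>p. (\<lambda>(t, x). F t x) (1 - fst p, ?g (snd p)))"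
    by (rule continuous_on_compose2[OF F(1)])
       (use gS in \<open>auto intro!: continuous_intros continuous_on_compose2[OF g_cont] simp del: mem_sphere_0\<close>)
  then have "continuous_on ({0..1} \<times> S3) (\<lambda>(t, x). F (1 - t) (?g x))"
    by (simp add: case_prod_unfold)
  moreover have "bij_betw (\<lambda>x. F (1 - t) (?g x)) S3 S3" if "t \<in> {0..1}" for t
    using bij_betw_trans[OF g, of "F (1 - t)" S3] F that by (auto simp: o_def)
  ultimately show ?thesis
    unfolding isotopic_to_id_iff using F(3) gS gf
    by (intro exI[of _ "\<lambda>t x. F (1 - t) (?g x)"]) (auto simp del: mem_sphere_0)
qed

lemma isotopic_trans:
  assumes "isotopic K L" "isotopic L J"
  shows "isotopic K J"
proof -
  obtain f g where "isotopic_to_id f" "f ` K = L" "isotopic_to_id g" "g ` L = J"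
    using assms unfolding isotopic_def by blast
  then show ?thesis
    unfolding isotopic_def by (intro exI[of _ "\<lambda>x. g (f x)"]) (auto intro: isotopic_to_id_comp)
qed

text \<open>
  This lets compositions of radially projected homogeneous maps be computed on representatives
  off the sphere.
\<close>

lemma radial_invariant:
  fixes H :: "c2 \<Rightarrow> c2"
  assumes "\<And>r x. r > 0 \<Longrightarrow> H (r *\<^sub>R x) = r *\<^sub>R H x"
  shows "sgn (H (sgn x)) = sgn (H x)"
proof (cases "x = 0")
  case False
  then have "H (sgn x) = inverse (norm x) *\<^sub>R H x"
    by (simp add: sgn_div_norm assms)
  then show ?thesis using False by (simp add: sgn_scaleR)
qed auto

text \<open>
  A positively homogeneous bijection permutes the rays from the origin, and \<open>S\<^sup>3\<close> is the space of
  these rays.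
\<close>

lemma isotopic_to_id_homogeneous:
  fixes H :: "real \<Rightarrow> c2 \<Rightarrow> c2"
  assumes cont: "continuous_on ({0..1} \<times> UNIV) (\<lambda>(t, x). H t x)"
    and bij: "\<And>t. t \<in> {0..1} \<Longrightarrow> bij (H t)"
    and hom: "\<And>t r x. t \<in> {0..1} \<Longrightarrow> r > 0 \<Longrightarrow> H t (r *\<^sub>R x) = r *\<^sub>R H t x"
    and H0: "\<And>x. H 0 x = x"
  shows "isotopic_to_id (\<lambda>x. sgn (H 1 x))"
proof -
  have zero: "H t x = 0 \<longleftrightarrow> x = 0" if t: "t \<in> {0..1}" for t x
  proof -
    have "H t 0 = 2 *\<^sub>R H t 0" using hom[OF t, of 2 0] by simp
    then have "H t 0 = 0" by (simp add: scaleR_2)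
    then show ?thesis using bij[OF t] by (metis bij_def injD)
  qed
  have "continuous_on ({0..1} \<times> S3) (\<lambda>(t, x). H t x)"
    by (rule continuous_on_subset[OF cont]) auto
  then have "continuous_on ({0..1} \<times> S3) (\<lambda>p. sgn ((\<lambda>(t, x). H t x) p))"
    using zero by (auto simp: sgn_div_norm intro!: continuous_intros)
  then have "continuous_on ({0..1} \<times> S3) (\<lambda>(t, x). sgn (H t x))"
    by (simp add: case_prod_unfold)
  moreover have "bij_betw (\<lambda>x. sgn (H t x)) S3 S3" if t: "t \<in> {0..1}" for t
  proof (rule bij_betw_imageI)
    show "inj_on (\<lambda>x. sgn (H t x)) S3"
    proof (rule inj_onI)
      fix x y assume x: "x \<in> S3" and y: "y \<in> S3" and eq: "sgn (H t x) = sgn (H t y)"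
      define r where "r = norm (H t x) / norm (H t y)"
      have nz: "H t x \<noteq> 0" "H t y \<noteq> 0" using x y zero[OF t] by auto
      then have r: "r > 0" by (simp add: r_def)
      have "H t x = norm (H t x) *\<^sub>R sgn (H t x)"
        using nz by (simp add: sgn_div_norm)
      also have "\<dots> = norm (H t x) *\<^sub>R sgn (H t y)" by (simp add: eq)
      also have "\<dots> = H t (r *\<^sub>R y)"
        using hom[OF t r] by (simp add: sgn_div_norm r_def divide_inverse)
      finally have "x = r *\<^sub>R y" using bij[OF t] by (meson bij_def injD)
      moreover from this have "r = 1" using x y r by simp
      ultimately show "x = y" by simp
    qed
    show "(\<lambda>x. sgn (H t x)) ` S3 = S3"
    proof (intro equalityI subsetI)
      fix y assume "y \<in> (\<lambda>x. sgn (H t x)) ` S3"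
      then show "y \<in> S3" using zero[OF t] by (auto simp: norm_sgn)
    next
      fix y assume y: "y \<in> S3"
      obtain x where x: "H t x = y" using bij[OF t] by (metis bij_def surjD)
      then have "x \<noteq> 0" using y zero[OF t, of x] by auto
      moreover have "sgn (H t (sgn x)) = y"
        using x y radial_invariant[of "H t" x] hom[OF t] by (simp add: sgn_div_norm)
      ultimately show "y \<in> (\<lambda>x. sgn (H t x)) ` S3"
        by (intro image_eqI[of _ _ "sgn x"]) (auto simp: norm_sgn)
    qed
  qed
  moreover have "sgn (H 0 x) = x" if "x \<in> S3" for x
    using that H0 by (simp add: sgn_div_norm)
  ultimately show ?thesis
    unfolding isotopic_to_id_iff by (intro exI[of _ "\<lambda>t x. sgn (H t x)"]) auto
qed

text \<open>
  The homogeneous extension of a function on the circle is continuous at \<open>0\<close> because the function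
  is bounded.
\<close>

lemma continuous_on_cone:
  fixes g :: "complex \<Rightarrow> 'a :: real_normed_vector"
  assumes "continuous_on S1 g"
  shows "continuous_on UNIV (\<lambda>a. norm a *\<^sub>R g (sgn a))"
proof -
  have "compact (g ` S1)" by (intro compact_continuous_image assms) auto
  then have "bounded (g ` S1)" by (rule compact_imp_bounded)
  then obtain B where B: "\<And>w. w \<in> S1 \<Longrightarrow> norm (g w) \<le> B"
    unfolding bounded_iff by blast
  have "isCont (\<lambda>a. norm a *\<^sub>R g (sgn a)) x" for x
  proof (cases "x = 0")
    case True
    have bound: "norm (norm a *\<^sub>R g (sgn a)) \<le> norm a * max B (norm (g 0))" for a
    proof -
      have "norm (g (sgn a)) \<le> max B (norm (g 0))"
        using B[of "sgn a"] by (cases "a = 0") (auto simp: norm_sgn)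
      then show ?thesis by (simp add: mult_left_mono)
    qed
    have lim: "((\<lambda>a. norm a * max B (norm (g 0))) \<longlongrightarrow> 0) (at (0::complex))"
      by (rule tendsto_eq_rhs, rule tendsto_intros) (rule tendsto_intros | simp)+
    have "((\<lambda>a. norm a *\<^sub>R g (sgn a)) \<longlongrightarrow> 0) (at 0)"
      by (rule Lim_null_comparison[OF always_eventually lim]) (rule allI, rule bound)
    then show ?thesis using True by (simp add: isCont_def)
  next
    case False
    have "continuous_on (- {0}) (sgn :: complex \<Rightarrow> complex)"
      by (rule continuous_on_sgn) (auto intro: continuous_on_id)
    then have "continuous_on (- {0}) (\<lambda>a. g (sgn a))"
      by (rule continuous_on_compose2[OF assms]) (auto simp: norm_sgn split: if_splits)
    then have "continuous_on (- {0}) (\<lambda>a. norm a *\<^sub>R g (sgn a))"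
      by (intro continuous_intros)
    then show ?thesis using False
      by (simp add: continuous_on_eq_continuous_at open_Compl)
  qed
  then show ?thesis by (simp add: continuous_at_imp_continuous_on)
qed

lemma isotopic_to_id_rotation: "isotopic_to_id (\<lambda>(a, b). (b, - a))"
proof -
  define c s where "c t = complex_of_real (cos (t * pi / 2))"
    and "s t = complex_of_real (sin (t * pi / 2))" for t :: real
  have cs: "c t * c t + s t * s t = 1" for t
    unfolding c_def s_def of_real_mult[symmetric] of_real_add[symmetric]
    by (metis of_real_1 power2_eq_square sin_cos_squared_add2)
  have "isotopic_to_id (\<lambda>x. sgn ((\<lambda>t (a, b). (c t * a + s t * b, c t * b - s t * a)) 1 x))"
  proof (rule isotopic_to_id_homogeneous)
    show "continuous_on ({0..1} \<times> UNIV) (\<lambda>(t, x). (\<lambda>(a, b). (c t * a + s t * b, c t * b - s t * a)) x)"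
      by (auto simp: case_prod_unfold c_def s_def intro!: continuous_intros)
    show "bij (\<lambda>(a, b). (c t * a + s t * b, c t * b - s t * a))" for t
    proof (rule o_bij[of "\<lambda>(a, b). (c t * a - s t * b, c t * b + s t * a)"])
      have "c t * (c t * z) + s t * (s t * z) = z" for z
        by (metis cs distrib_right mult.assoc mult_1)
      then show "(\<lambda>(a, b). (c t * a - s t * b, c t * b + s t * a)) \<circ> (\<lambda>(a, b). (c t * a + s t * b, c t * b - s t * a)) = id"
         "(\<lambda>(a, b). (c t * a + s t * b, c t * b - s t * a)) \<circ> (\<lambda>(a, b). (c t * a - s t * b, c t * b + s t * a)) = id"
        by (auto simp: fun_eq_iff algebra_simps)
    qed
  qed (auto simp: c_def s_def algebra_simps)
  then have "isotopic_to_id (\<lambda>x. sgn (snd x, - fst x))"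
    by (simp add: c_def s_def case_prod_unfold)
  then show ?thesis
    by (rule isotopic_to_id_cong[THEN iffD1, rotated])
       (auto simp: case_prod_unfold sgn_div_norm norm_prod_def add.commute)
qed

lemma isotopic_to_id_shear:
  fixes g :: "complex \<Rightarrow> complex"
  assumes "continuous_on S1 g"
  shows "isotopic_to_id (\<lambda>x. sgn (fst x, snd x + norm (fst x) *\<^sub>R g (sgn (fst x))))"
proof -
  define \<eta> where "\<eta> a = norm a *\<^sub>R g (sgn a)" for a
  have \<eta>: "continuous_on UNIV \<eta>"
    unfolding \<eta>_def by (rule continuous_on_cone[OF assms])
  have hom: "\<eta> (r *\<^sub>R a) = r *\<^sub>R \<eta> a" if "r > 0" for r a
    using that by (simp add: \<eta>_def sgn_scaleR)
  have "isotopic_to_id (\<lambda>x. sgn ((\<lambda>t x. (fst x, snd x + t *\<^sub>R \<eta> (fst x))) 1 x))"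
  proof (rule isotopic_to_id_homogeneous)
    show "continuous_on ({0..1} \<times> UNIV) (\<lambda>(t, x). (fst x, snd x + t *\<^sub>R \<eta> (fst x)))"
      by (auto simp: case_prod_unfold intro!: continuous_intros continuous_on_compose2[OF \<eta>])
    show "bij (\<lambda>x. (fst x, snd x + t *\<^sub>R \<eta> (fst x)))" for t
      by (rule o_bij[of "\<lambda>x. (fst x, snd x - t *\<^sub>R \<eta> (fst x))"]) auto
  qed (auto simp: hom algebra_simps)
  then show ?thesis by (simp add: \<eta>_def)
qed

text \<open>
  Rescaling the first coordinate rather than the second keeps the map continuous where the first
  coordinate vanishes and its direction is undefined.
\<close>

lemma isotopic_to_id_scaling:
  fixes \<sigma> :: "complex \<Rightarrow> real"
  assumes "continuous_on S1 \<sigma>" and pos: "\<And>w. \<sigma> w > 0"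
  shows "isotopic_to_id (\<lambda>x. sgn (\<sigma> (sgn (fst x)) *\<^sub>R fst x, snd x))"
proof -
  define s where "s t a = 1 - t + t * \<sigma> (sgn a)" for t a
  have s: "s t a > 0" if "t \<in> {0..1}" for t a
    using that pos[of "sgn a"] unfolding s_def
    by (cases "t = 0") (auto intro!: add_nonneg_pos)
  have "continuous_on UNIV (\<lambda>a. norm a *\<^sub>R (\<sigma> (sgn a) *\<^sub>R sgn a))"
    by (rule continuous_on_cone[where g = "\<lambda>w. \<sigma> w *\<^sub>R w"]) (intro continuous_intros assms)
  moreover have "norm a *\<^sub>R (\<sigma> (sgn a) *\<^sub>R sgn a) = \<sigma> (sgn a) *\<^sub>R a" for a
    by (cases "a = 0") (simp_all add: sgn_div_norm)
  moreover define \<eta> where "\<eta> a = \<sigma> (sgn a) *\<^sub>R a" for a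
  ultimately have \<eta>: "continuous_on UNIV \<eta>"
    by (simp add: \<eta>_def[abs_def])
  have "isotopic_to_id (\<lambda>x. sgn ((\<lambda>t x. (s t (fst x) *\<^sub>R fst x, snd x)) 1 x))"
  proof (rule isotopic_to_id_homogeneous)
    have "continuous_on ({0..1} \<times> (UNIV :: c2 set)) (\<lambda>(t, x). ((1 - t) *\<^sub>R fst x + t *\<^sub>R \<eta> (fst x), snd x))"
      by (auto simp: case_prod_unfold intro!: continuous_intros continuous_on_compose2[OF \<eta>])
    then show "continuous_on ({0..1} \<times> (UNIV :: c2 set)) (\<lambda>(t, x). (s t (fst x) *\<^sub>R fst x, snd x))"
      by (simp add: s_def \<eta>_def algebra_simps)
    show "bij (\<lambda>x::c2. (s t (fst x) *\<^sub>R fst x, snd x))" if t: "t \<in> {0..1}" for t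
    proof (rule o_bij[of "\<lambda>x. (inverse (s t (fst x)) *\<^sub>R fst x, snd x)"])
      have "s t (r *\<^sub>R a) = s t a" if "r > 0" for r a
        using that by (simp add: s_def sgn_scaleR)
      then show "(\<lambda>x. (inverse (s t (fst x)) *\<^sub>R fst x, snd x)) \<circ> (\<lambda>x. (s t (fst x) *\<^sub>R fst x, snd x)) = id"
        "(\<lambda>x. (s t (fst x) *\<^sub>R fst x, snd x)) \<circ> (\<lambda>x. (inverse (s t (fst x)) *\<^sub>R fst x, snd x)) = id"
        using s[OF t] by (auto simp: fun_eq_iff less_imp_neq[THEN not_sym])
    qed
  qed (auto simp: s_def sgn_scaleR)
  then show ?thesis by (simp add: s_def)
qed

lemma isotopic_to_id_twist:
  fixes \<theta> :: "complex \<Rightarrow> real"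
  assumes "continuous_on UNIV \<theta>"
  shows "isotopic_to_id (\<lambda>x. (fst x, snd x * cis (\<theta> (fst x))))"
proof -
  let ?F = "\<lambda>t x. (fst x, snd x * cis (t * \<theta> (fst x)))"
  have "continuous_on ({0..1} \<times> S3) (\<lambda>(t, x). ?F t x)"
    by (auto simp: case_prod_unfold intro!: continuous_intros continuous_on_compose2[OF assms])
  moreover have "bij_betw (?F t) S3 S3" for t
    by (rule bij_betw_byWitness[where f' = "\<lambda>x. (fst x, snd x * cis (- t * \<theta> (fst x)))"])
       (auto simp: cis_mult norm_prod_def norm_mult mult.assoc)
  ultimately show ?thesis
    unfolding isotopic_to_id_iff by (intro exI[of _ ?F]) auto
qed

lemma isotopic_to_id_negate_snd: "isotopic_to_id (\<lambda>x. (fst x, - snd x))"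
  using isotopic_to_id_twist[of "\<lambda>_. pi"] by simp

section \<open>Blowing down the standard unknot\<close>

text \<open>
  A full left-handed twist of the solid torus \<open>|z1| \<ge> |z2|\<close> about the axis \<open>z1 = 0\<close>.
\<close>

definition untwist :: "c2 \<Rightarrow> c2" where
  "untwist x = (fst x, snd x * cnj (sgn (fst x)))"

text \<open>
  Where \<open>Re z1\<close> is large, \<open>arg z1\<close> is an arctangent.  Cutting that formula off elsewhere gives a
  function on all of \<open>\<complex>\<close>, and the twist by this function is isotopic to the identity and agrees
  with \<open>untwist\<close> on an open set.
\<close>

lemma orientation_preserving_untwist:
  assumes f: "isotopic_to_id f"
  shows "orientation_preserving_on (f ` {x \<in> S3. norm (snd x) \<le> norm (fst x)}) (untwist \<circ> the_inv_into S3 f)"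
proof -
  define \<theta> where "\<theta> a = - arctan (Im a / max (Re a) (1/2))" for a
  define g where "g x = (fst x, snd x * cis (\<theta> (fst x)))" for x :: c2
  define V where "V = S3 \<inter> {x. Re (fst x) > 1/2 \<and> norm (snd x) < norm (fst x)}"
  note f' = isotopic_to_id_homeomorphism[OF f]
  have inv: "the_inv_into S3 f (f x) = x" if "x \<in> S3" for x
    using f'(2) that by (simp add: bij_betw_def the_inv_into_f_f)
  have "continuous_on UNIV \<theta>"
    unfolding \<theta>_def by (intro continuous_intros) (auto simp: max_def)
  then have "isotopic_to_id g" unfolding g_def by (rule isotopic_to_id_twist)
  then have g: "isotopic_to_id (\<lambda>x. g (the_inv_into S3 f x))"
    by (rule isotopic_to_id_comp[OF isotopic_to_id_inverse[OF f]])
  have eq: "untwist x = g x" if "x \<in> V" for x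
  proof -
    have "cnj (sgn a) = cis (- arctan (Im a / Re a))" if "Re a > 0" for a
    proof -
      have "Arg a = arctan (Im a / Re a)"
        using that by (simp add: arg_conv_arctan)
      moreover have "a \<noteq> 0" using that by auto
      ultimately show ?thesis using cis_Arg[of a] by (metis cis_cnj)
    qed
    then show ?thesis using that by (simp add: untwist_def g_def V_def \<theta>_def max_def)
  qed
  have "open {x :: c2. Re (fst x) > 1/2 \<and> norm (snd x) < norm (fst x)}"
    by (intro open_Collect_conj open_Collect_less continuous_intros)
  then have V: "openin (top_of_set S3) V"
    unfolding V_def by (rule openin_open_Int)
  have "openin (top_of_set S3) (f ` V)"
  proof -
    have "homeomorphism S3 S3 f (the_inv_into S3 f)"
      using f' isotopic_to_id_homeomorphism[OF isotopic_to_id_inverse[OF f]]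
      unfolding homeomorphism_def by (metis bij_betw_def the_inv_into_f_f f_the_inv_into_f)
    then show ?thesis using V by (rule homeomorphism_imp_open_map)
  qed
  moreover have "(1, 0) \<in> V" by (simp add: V_def norm_Pair)
  then have "f ` V \<noteq> {}" by blast
  moreover have "f ` V \<subseteq> f ` {x \<in> S3. norm (snd x) \<le> norm (fst x)}"
    by (rule image_mono) (auto simp: V_def)
  moreover have "\<forall>y\<in>f ` V. (untwist \<circ> the_inv_into S3 f) y = g (the_inv_into S3 f y)"
    using eq by (simp add: inv V_def)
  ultimately show ?thesis
    unfolding orientation_preserving_on_def using g by blast
qed

lemma sgn_Pair:
  fixes a b :: complex
  shows "sgn (a, b) = (a /\<^sub>R norm (a, b), b /\<^sub>R norm (a, b))"
  by (simp add: sgn_div_norm)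

lemma sgn_in_S3: "x \<noteq> 0 \<Longrightarrow> sgn x \<in> S3" for x :: c2
  by (simp add: norm_sgn)

lemma norm_untwist: "fst x \<noteq> 0 \<Longrightarrow> norm (untwist x) = norm x"
  by (simp add: untwist_def norm_prod_def norm_mult norm_sgn)

lemma untwist_sgn: "fst x \<noteq> 0 \<Longrightarrow> untwist (sgn x) = sgn (untwist x)"
  using norm_untwist[of x]
  by (cases x) (simp add: untwist_def sgn_Pair sgn_scaleR norm_Pair[symmetric] zero_prod_def)

lemma param_standard_nbhd:
  shows "(\<lambda>x. sgn (snd x, fst x)) ` solid_torus = {x \<in> S3. norm (fst x) \<le> norm (snd x)}"
    and "(\<lambda>x. sgn (snd x, fst x)) ` (S1 \<times> ball 0 1) = {x \<in> S3. norm (fst x) < norm (snd x)}"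
proof -
  have sub: "sgn (v, w) \<in> {x \<in> S3. norm (fst x) \<le> norm (snd x)}"
       "norm v < 1 \<Longrightarrow> norm (fst (sgn (v, w))) < norm (snd (sgn (v, w)))"
    if "norm w = 1" "norm v \<le> 1" for w v :: complex
  proof -
    have "(v, w) \<noteq> 0" using that by (auto simp: zero_prod_def)
    then show "sgn (v, w) \<in> {x \<in> S3. norm (fst x) \<le> norm (snd x)}"
       "norm v < 1 \<Longrightarrow> norm (fst (sgn (v, w))) < norm (snd (sgn (v, w)))"
      using that sgn_in_S3 by (auto simp: sgn_Pair mult_left_mono)
  qed
  have sup: "\<exists>w v. norm w = 1 \<and> norm v \<le> 1 \<and> (norm (fst x) < norm (snd x) \<longrightarrow> norm v < 1) \<and> x = sgn (v, w)"
    if "norm x = 1" "norm (fst x) \<le> norm (snd x)" for x :: c2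
  proof (intro exI conjI impI)
    have "snd x \<noteq> 0" using that by (cases x) (auto simp: zero_prod_def norm_Pair)
    then show "norm (sgn (snd x)) = 1" "norm (fst x /\<^sub>R norm (snd x)) \<le> 1"
        "norm (fst x) < norm (snd x) \<Longrightarrow> norm (fst x /\<^sub>R norm (snd x)) < 1"
      using that by (auto simp: norm_sgn field_simps)
    have "(fst x /\<^sub>R norm (snd x), sgn (snd x)) = inverse (norm (snd x)) *\<^sub>R x"
      by (cases x) (simp add: sgn_div_norm)
    then show "x = sgn (fst x /\<^sub>R norm (snd x), sgn (snd x))"
      using that \<open>snd x \<noteq> 0\<close> by (simp add: sgn_scaleR) (simp add: sgn_div_norm)
  qed
  show "(\<lambda>x. sgn (snd x, fst x)) ` solid_torus = {x \<in> S3. norm (fst x) \<le> norm (snd x)}"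
    using sub(1) sup by (fastforce simp: image_iff)
  show "(\<lambda>x. sgn (snd x, fst x)) ` (S1 \<times> ball 0 1) = {x \<in> S3. norm (fst x) < norm (snd x)}"
    using sub sup by (fastforce simp: image_iff)
qed

text \<open>
  The new solid torus fills the same part of \<open>S\<^sup>3\<close> as the removed one, with the same meridian
  discs: its fibre over \<open>u\<close> is the old meridian disc over \<open>cnj u\<close>, rotated by \<open>u\<close>.
\<close>

lemma param_new_solid_torus:
  assumes "\<And>u. u \<in> S1 \<Longrightarrow> (\<lambda>v. u * v) ` A = A"
  shows "(\<lambda>x. sgn (fst x * snd x, cnj (fst x))) ` (S1 \<times> A) = (\<lambda>x. sgn (snd x, fst x)) ` (S1 \<times> A)"
proof (intro equalityI subsetI)
  fix y assume "y \<in> (\<lambda>x. sgn (fst x * snd x, cnj (fst x))) ` (S1 \<times> A)"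
  then obtain u v where uv: "u \<in> S1" "v \<in> A" "y = sgn (u * v, cnj u)" by auto
  have "u * v \<in> A" using assms[OF uv(1)] uv(2) by blast
  then show "y \<in> (\<lambda>x. sgn (snd x, fst x)) ` (S1 \<times> A)"
    using uv by (intro image_eqI[of _ _ "(cnj u, u * v)"]) auto
next
  fix y assume "y \<in> (\<lambda>x. sgn (snd x, fst x)) ` (S1 \<times> A)"
  then obtain w v where wv: "w \<in> S1" "v \<in> A" "y = sgn (v, w)" by auto
  have "cnj w \<in> S1" using wv(1) by simp
  then obtain v' where "v' \<in> A" "v = cnj w * v'" using assms[of "cnj w"] wv(2) by blast
  then show "y \<in> (\<lambda>x. sgn (fst x * snd x, cnj (fst x))) ` (S1 \<times> A)"
    using wv by (intro image_eqI[of _ _ "(cnj w, v')"]) auto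
qed

lemma unit_mult_cnj: "norm u = 1 \<Longrightarrow> u * cnj u = 1" "norm u = 1 \<Longrightarrow> cnj u * u = 1"
  using complex_norm_square[of u] by (simp_all add: mult.commute)

lemma rotation_image_ball:
  assumes "u \<in> S1"
  shows "(\<lambda>v. u * v) ` cball 0 1 = cball 0 1" "(\<lambda>v. u * v) ` ball 0 1 = ball 0 1"
proof -
  have norms: "norm (u * v) = norm v" "norm (cnj u * v) = norm v" "u * (cnj u * v) = v" for v
    using assms by (simp_all add: norm_mult mult.assoc[symmetric] unit_mult_cnj)
  have image: "(\<lambda>v. u * v) ` B = B" if "\<And>v w. norm v = norm w \<Longrightarrow> v \<in> B \<longleftrightarrow> w \<in> B" for B
  proof (intro equalityI subsetI)
    fix v assume "v \<in> B"
    then have "cnj u * v \<in> B" using that norms(2) by metis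
    then show "v \<in> (\<lambda>v. u * v) ` B" using norms(3)[of v] by (intro image_eqI) simp_all
  qed (use that norms(1) in blast)
  show "(\<lambda>v. u * v) ` cball 0 1 = cball 0 1" "(\<lambda>v. u * v) ` ball 0 1 = ball 0 1"
    by (rule image, simp)+
qed

lemma inj_new_solid_torus:
  "inj_on (\<lambda>x. sgn (fst x * snd x, cnj (fst x))) solid_torus"
proof (rule inj_onI)
  fix x x' :: c2
  assume x: "x \<in> solid_torus" "x' \<in> solid_torus"
    and eq': "sgn (fst x * snd x, cnj (fst x)) = sgn (fst x' * snd x', cnj (fst x'))"
  obtain u v u' v' where uv: "x = (u, v)" "x' = (u', v')" by (metis surj_pair)
  have u: "norm u = 1" "norm u' = 1" and eq: "sgn (u * v, cnj u) = sgn (u' * v', cnj u')"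
    using x eq' uv by auto
  define r where "r = inverse (norm (u * v, cnj u))"
  define r' where "r' = inverse (norm (u' * v', cnj u'))"
  have eqs: "r *\<^sub>R (u * v) = r' *\<^sub>R (u' * v')" "r *\<^sub>R cnj u = r' *\<^sub>R cnj u'"
    using eq by (simp_all add: sgn_Pair r_def r'_def)
  have pos: "r > 0" "r' > 0" using u by (auto simp: r_def r'_def zero_prod_def)
  have "norm (r *\<^sub>R cnj u) = norm (r' *\<^sub>R cnj u')" using eqs by simp
  then have "r = r'" using u pos by simp
  then have "cnj u = cnj u'" "u * v = u' * v'" using eqs pos by auto
  then have "u = u'" by simp
  moreover have "u \<noteq> 0" using u by auto
  ultimately show "x = x'" using \<open>u * v = u' * v'\<close> uv by simp
qed

text \<open>
  The exterior of \<open>f ` unknot\<close> is the image of the solid torus \<open>|z1| \<ge> |z2|\<close>.  In this solid torus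
  the attaching curves are \<open>v \<mapsto> (uv, v)\<close>; the left-handed twist turns them into
  \<open>v \<mapsto> (uv, cnj u)\<close>, which bound the discs \<open>|v| \<le> 1\<close> in the complement.  Hence the twist
  and these discs identify the surgered manifold with \<open>S\<^sup>3\<close>.
\<close>

lemma blow_down_plus_one:
  assumes f: "isotopic_to_id f"
    and L: "L \<subseteq> {x \<in> S3. norm (snd x) < norm (fst x)}"
    and J: "isotopic (untwist ` L) J"
  shows "J \<in> blow_down 1 (f ` unknot) (f ` L)"
proof -
  define P where "P = {x \<in> S3. norm (snd x) \<le> norm (fst x)}"
  define f' where "f' = the_inv_into S3 f"
  define \<phi> where "\<phi> = (\<lambda>x. f (sgn (snd x, fst x)))"
  define h where "h = untwist \<circ> f'"
  define \<psi> :: "c2 \<Rightarrow> c2" where "\<psi> = (\<lambda>x. sgn (fst x * snd x, cnj (fst x)))"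
  note hf = isotopic_to_id_homeomorphism[OF f]
  note hf' = isotopic_to_id_homeomorphism[OF isotopic_to_id_inverse[OF f], folded f'_def]
  have inj: "inj_on f S3" and onto: "f ` S3 = S3" using hf(2) by (auto simp: bij_betw_def)
  have f'f: "f' (f x) = x" if "x \<in> S3" for x
    using inj that by (simp add: f'_def the_inv_into_f_f)
  have P_nz: "fst x \<noteq> 0" if "x \<in> P" for x
    using that by (cases x) (auto simp: P_def norm_Pair)
  have \<phi>_solid: "\<phi> ` (S1 \<times> ball 0 1) = f ` {x \<in> S3. norm (fst x) < norm (snd x)}"
     "\<phi> ` solid_torus = f ` {x \<in> S3. norm (fst x) \<le> norm (snd x)}"
    unfolding \<phi>_def param_standard_nbhd[symmetric] image_image by simp_all
  have "exterior \<phi> = f ` (S3 - {x \<in> S3. norm (fst x) < norm (snd x)})"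
    unfolding exterior_def \<phi>_solid by (subst inj_on_image_set_diff[OF inj]) (auto simp: onto)
  also have "S3 - {x \<in> S3. norm (fst x) < norm (snd x)} = P"
    by (auto simp: P_def)
  finally have ext: "exterior \<phi> = f ` P" .
  have PS: "P \<subseteq> S3" by (auto simp: P_def)
  have f'P: "f' ` f ` P = P"
    using PS f'f by (force simp: image_image)
  have untwist_P: "untwist x \<in> P" if "x \<in> P" for x
    using that P_nz[OF that] norm_untwist[of x] by (simp add: P_def) (simp add: untwist_def norm_mult norm_sgn)
  have untwist_bij: "bij_betw untwist P P"
  proof (rule bij_betw_byWitness[where f' = "\<lambda>x. (fst x, snd x * sgn (fst x))"])
    have unit: "z * (cnj (sgn a) * sgn a) = z" "z * (sgn a * cnj (sgn a)) = z" if "a \<noteq> 0" for a z :: complex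
      using that by (simp_all add: unit_mult_cnj norm_sgn)
    show "\<forall>x\<in>P. (fst (untwist x), snd (untwist x) * sgn (fst (untwist x))) = x"
         "\<forall>x\<in>P. untwist (fst x, snd x * sgn (fst x)) = x"
      using P_nz by (auto simp: untwist_def mult.assoc unit)
    show "untwist ` P \<subseteq> P" using untwist_P by auto
    show "(\<lambda>x. (fst x, snd x * sgn (fst x))) ` P \<subseteq> P"
      using P_nz by (auto simp: P_def norm_prod_def norm_mult norm_sgn)
  qed
  have hP: "h ` exterior \<phi> = P"
    using untwist_bij unfolding h_def ext image_comp[symmetric] f'P by (simp only: bij_betw_def)
  have \<psi>_solid: "\<psi> ` (S1 \<times> ball 0 1) = {x \<in> S3. norm (fst x) < norm (snd x)}"
     "\<psi> ` solid_torus = {x \<in> S3. norm (fst x) \<le> norm (snd x)}"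
    unfolding \<psi>_def
    using param_new_solid_torus[OF rotation_image_ball(1)] param_new_solid_torus[OF rotation_image_ball(2)]
    by (simp_all only: param_standard_nbhd)
  have "preferred_nbhd (f ` unknot) \<phi>"
    unfolding preferred_nbhd_def \<phi>_def using f by auto
  moreover have "f ` L \<inter> \<phi> ` solid_torus = {}"
  proof -
    have "L \<inter> {x \<in> S3. norm (fst x) \<le> norm (snd x)} = {}" using L by fastforce
    then show ?thesis
      unfolding \<phi>_solid using L by (subst inj_on_image_Int[OF inj, symmetric]) auto
  qed
  moreover have "surgery_is_sphere 1 \<phi> h \<psi>"
    unfolding surgery_is_sphere_def
  proof (intro conjI ballI)
    show "continuous_on (exterior \<phi>) h"
      unfolding h_def
    proof (rule continuous_on_compose)
      show "continuous_on (exterior \<phi>) f'"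
        by (rule continuous_on_subset[OF hf'(1)]) (auto simp: exterior_def)
      show "continuous_on (f' ` exterior \<phi>) untwist"
        unfolding ext f'P untwist_def sgn_div_norm
        by (intro continuous_intros) (use P_nz in auto)
    qed
    show "inj_on h (exterior \<phi>)"
      unfolding h_def
    proof (rule comp_inj_on)
      show "inj_on f' (exterior \<phi>)"
        using hf'(2) by (auto simp: bij_betw_def exterior_def intro: inj_on_subset)
      show "inj_on untwist (f' ` exterior \<phi>)"
        using untwist_bij by (simp add: ext f'P bij_betw_def)
    qed
    show "orientation_preserving_on (exterior \<phi>) h"
      unfolding ext h_def f'_def P_def by (rule orientation_preserving_untwist[OF f])
    show "continuous_on solid_torus \<psi>"
      unfolding \<psi>_def by (intro continuous_on_sgn continuous_intros) (auto simp: zero_prod_def)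
    show "inj_on \<psi> solid_torus"
      unfolding \<psi>_def by (rule inj_new_solid_torus)
    show "\<psi> (u, v) = h (\<phi> (v, u * v powi 1))" if u: "u \<in> S1" and v: "v \<in> S1" for u v
    proof -
      have nz: "u \<noteq> 0" "v \<noteq> 0" using u v by auto
      have "(u * v, v) \<noteq> 0" using nz by (simp add: zero_prod_def)
      then have "h (\<phi> (v, u * v powi 1)) = untwist (sgn (u * v, v))"
        unfolding h_def \<phi>_def using f'f[OF sgn_in_S3] by simp
      also have "\<dots> = sgn (untwist (u * v, v))" using nz by (simp add: untwist_sgn)
      also have "untwist (u * v, v) = (u * v, cnj u)"
      proof -
        have "sgn (u * v) = u * v" using u v by (simp add: sgn_div_norm norm_mult)
        moreover have "v * cnj (u * v) = cnj u * (v * cnj v)" by simp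
        moreover have "v * cnj v = 1" using v by (simp add: unit_mult_cnj)
        ultimately show ?thesis by (simp add: untwist_def)
      qed
      finally show ?thesis by (simp add: \<psi>_def)
    qed
    show "h ` exterior \<phi> \<inter> \<psi> ` (S1 \<times> ball 0 1) = {}"
      unfolding hP \<psi>_solid by (auto simp: P_def)
    show "h ` exterior \<phi> \<union> \<psi> ` solid_torus = S3"
      unfolding hP \<psi>_solid by (auto simp: P_def)
  qed
  moreover have "h ` f ` L = untwist ` L"
  proof -
    have "f' ` f ` L = L" using L f'f by (force simp: image_image)
    then show ?thesis unfolding h_def image_comp[symmetric] by (simp only:)
  qed
  ultimately show ?thesis
    unfolding blow_down_def using J by (intro CollectI exI[of _ \<phi>] exI[of _ h] exI[of _ \<psi>]) simp
qed

section \<open>Links that are graphs over a circle\<close>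

definition curve :: "(complex \<Rightarrow> c2) \<Rightarrow> c2 set" where
  "curve c = (\<lambda>w. sgn (c w)) ` S1"

lemma curve_cong: "(\<And>w. norm w = 1 \<Longrightarrow> sgn (c w) = sgn (d w)) \<Longrightarrow> curve c = curve d"
  unfolding curve_def by (rule image_cong) auto

lemma scaling_curve:
  fixes a :: "complex \<Rightarrow> complex"
  assumes "continuous_on S1 \<sigma>" "\<And>w. w \<in> S1 \<Longrightarrow> \<sigma> w > 0"
  obtains F where "isotopic_to_id F"
    "\<And>a b. norm a = 1 \<Longrightarrow> F (sgn (a, b)) = sgn (\<sigma> a *\<^sub>R a, b)"
proof -
  \<comment> \<open>The rescaling needs a positive factor also at \<open>sgn 0 = 0\<close>, off the circle.\<close>
  define s where "s w = (if w \<in> S1 then \<sigma> w else 1)" for w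
  define H where "H x = (s (sgn (fst x)) *\<^sub>R fst x, snd x)" for x :: c2
  have "isotopic_to_id (\<lambda>x. sgn (H x))"
    unfolding H_def
  proof (rule isotopic_to_id_scaling)
    show "continuous_on S1 s"
      by (rule continuous_on_eq[OF assms(1)]) (simp add: s_def)
    show "s w > 0" for w using assms(2) by (simp add: s_def)
  qed
  moreover have "sgn (H (sgn (a, b))) = sgn (\<sigma> a *\<^sub>R a, b)" if "norm a = 1" for a b
  proof -
    have "sgn (H (sgn (a, b))) = sgn (H (a, b))"
      by (rule radial_invariant) (simp add: H_def sgn_scaleR)
    also have "H (a, b) = (\<sigma> a *\<^sub>R a, b)"
      using that by (simp add: H_def s_def sgn_div_norm)
    finally show ?thesis .
  qed
  ultimately show ?thesis by (rule that)
qed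

lemma shear_curve:
  assumes "continuous_on S1 g"
  obtains F where "isotopic_to_id F"
    "\<And>a b. norm a = 1 \<Longrightarrow> F (sgn (a, b)) = sgn (a, b + g a)"
proof -
  define H where "H x = (fst x, snd x + norm (fst x) *\<^sub>R g (sgn (fst x)))" for x :: c2
  have "isotopic_to_id (\<lambda>x. sgn (H x))"
    unfolding H_def by (rule isotopic_to_id_shear[OF assms])
  moreover have "sgn (H (sgn (a, b))) = sgn (a, b + g a)" if "norm a = 1" for a b
  proof -
    have "sgn (H (sgn (a, b))) = sgn (H (a, b))"
      by (rule radial_invariant) (simp add: H_def sgn_scaleR scaleR_add_right)
    also have "H (a, b) = (a, b + g a)"
      using that by (simp add: H_def sgn_div_norm)
    finally show ?thesis .
  qed
  ultimately show ?thesis by (rule that)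
qed

text \<open>
  The phase change is damped by \<open>|z1|\<close> to be continuous at \<open>z1 = 0\<close>.  On the torus \<open>|z1| = |z2|\<close> of
  \<open>S\<^sup>3\<close>, where \<open>|z1| = 1 / sqrt 2\<close>, the factor \<open>sqrt 2\<close> compensates the damping.
\<close>

lemma rephase_curve:
  assumes "continuous_on S1 \<gamma>"
  obtains F where "isotopic_to_id F"
    "\<And>a b. norm a = 1 \<Longrightarrow> norm b = 1 \<Longrightarrow> F (sgn (a, b)) = sgn (a, b * cis (\<gamma> a))"
proof -
  define \<theta> where "\<theta> a = sqrt 2 * (norm a *\<^sub>R \<gamma> (sgn a))" for a
  define F where "F x = (fst x, snd x * cis (\<theta> (fst x)))" for x :: c2
  have "isotopic_to_id F"
    unfolding F_def \<theta>_def
    by (intro isotopic_to_id_twist continuous_on_mult continuous_on_const continuous_on_cone[OF assms])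
  moreover have "F (sgn (a, b)) = sgn (a, b * cis (\<gamma> a))" if "norm a = 1" "norm b = 1" for a b
  proof -
    have "norm (a, b) = sqrt 2" "norm (a, b * cis (\<gamma> a)) = sqrt 2"
      using that by (simp_all add: norm_Pair norm_mult)
    moreover have "\<theta> (a /\<^sub>R sqrt 2) = \<gamma> a"
      using that by (simp add: \<theta>_def sgn_scaleR) (simp add: sgn_div_norm)
    ultimately show ?thesis by (simp add: F_def sgn_Pair)
  qed
  ultimately show ?thesis by (rule that)
qed

lemma rotation_sgn: "(\<lambda>(a, b). (b, - a)) (sgn (a, b)) = sgn (b, - a)" for a b :: complex
  by (simp add: sgn_Pair norm_Pair add.commute)

lemma unknot_eq_curve: "unknot = curve (\<lambda>w. (0, w))"
  unfolding unknot_def curve_def by (auto simp: sgn_Pair norm_Pair image_iff)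

text \<open>
  The curve \<open>w \<mapsto> (c w\<^sup>m, w)\<close> is rotated to \<open>(w, -c w\<^sup>m)\<close> and sheared to
  \<open>(w, (1-c) w\<^sup>m)\<close>.  For both \<open>c = 0\<close> and \<open>c = 2\<close> it then lies on the torus \<open>|z1| = |z2|\<close>,
  where it can be rephased by \<open>\<gamma>\<close> and rescaled by \<open>\<rho>\<close> to the graph of \<open>(1-c) f\<close>.  So one map
  takes care of both components.
\<close>

lemma straighten_graph_link:
  fixes m :: int and \<rho> \<gamma> :: "complex \<Rightarrow> real"
  assumes \<rho>: "continuous_on S1 \<rho>" and \<gamma>: "continuous_on S1 \<gamma>"
    and pos: "\<And>w. w \<in> S1 \<Longrightarrow> \<rho> w > 0"
    and f: "\<And>w. w \<in> S1 \<Longrightarrow> f w = \<rho> w *\<^sub>R (w powi m * cis (\<gamma> w))"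
  obtains F where "isotopic_to_id F" "F ` unknot = curve (\<lambda>w. (w, f w))"
    "F ` curve (\<lambda>w. (2 * w powi m, w)) = curve (\<lambda>w. (w, - f w))"
proof -
  have "continuous_on S1 (\<lambda>w. w powi m)"
    by (intro continuous_intros) auto
  then obtain S where S: "isotopic_to_id S" "\<And>a b. norm a = 1 \<Longrightarrow> S (sgn (a, b)) = sgn (a, b + a powi m)"
    by (rule shear_curve) blast
  obtain P where P: "isotopic_to_id P"
      "\<And>a b. norm a = 1 \<Longrightarrow> norm b = 1 \<Longrightarrow> P (sgn (a, b)) = sgn (a, b * cis (\<gamma> a))"
    by (rule rephase_curve[OF \<gamma>]) blast
  have "continuous_on S1 (\<lambda>w. inverse (\<rho> w))" "\<And>w. w \<in> S1 \<Longrightarrow> inverse (\<rho> w) > 0"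
    using pos by (auto intro!: continuous_intros \<rho> simp: less_imp_neq[THEN not_sym])
  then obtain M where M: "isotopic_to_id M"
      "\<And>a b. norm a = 1 \<Longrightarrow> M (sgn (a, b)) = sgn (inverse (\<rho> a) *\<^sub>R a, b)"
    by (rule scaling_curve) (assumption, rule that)
  define F where "F x = M (P (S ((\<lambda>(a, b). (b, - a)) x)))" for x
  have "isotopic_to_id F"
    unfolding F_def
    using isotopic_to_id_comp[OF isotopic_to_id_comp[OF isotopic_to_id_comp[OF isotopic_to_id_rotation S(1)] P(1)] M(1)] .
  moreover have F: "F (sgn (c * w powi m, w)) = sgn (w, (1 - c) * f w)"
    if w: "norm w = 1" and c: "norm (1 - c) = 1" for c w
  proof -
    have "- (c * w powi m) + w powi m = (1 - c) * w powi m" by (simp add: algebra_simps)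
    moreover have "norm ((1 - c) * w powi m) = 1"
      using w c by (simp add: norm_mult norm_power_int)
    ultimately have "F (sgn (c * w powi m, w)) = sgn (inverse (\<rho> w) *\<^sub>R w, (1 - c) * w powi m * cis (\<gamma> w))"
      unfolding F_def rotation_sgn using w by (simp add: S P M)
    also have "\<dots> = sgn (\<rho> w *\<^sub>R (inverse (\<rho> w) *\<^sub>R w, (1 - c) * w powi m * cis (\<gamma> w)))"
      using pos[of w] w by (simp add: sgn_scaleR del: scaleR_Pair)
    also have "\<rho> w *\<^sub>R (inverse (\<rho> w) *\<^sub>R w, (1 - c) * w powi m * cis (\<gamma> w)) = (w, (1 - c) * f w)"
      using pos[of w] f[of w] w by (simp add: scaleR_conv_of_real)
    finally show ?thesis .
  qed
  moreover have "F ` unknot = curve (\<lambda>w. (w, f w))"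
    using F[of _ 0] unfolding unknot_eq_curve curve_def image_image
    by (intro image_cong) auto
  moreover have "F ` curve (\<lambda>w. (2 * w powi m, w)) = curve (\<lambda>w. (w, - f w))"
    using F[of _ 2] unfolding curve_def image_image
    by (intro image_cong) auto
  ultimately show ?thesis by (intro that)
qed

lemma cnj_unit: "norm w = 1 \<Longrightarrow> cnj w = inverse w"
  using inverse_unique[OF unit_mult_cnj(1)] by simp

lemma untwist_curve: "untwist ` curve (\<lambda>w. (2 * w powi m, w)) = curve (\<lambda>w. (2 * w powi m, w powi (1 - m)))"
  unfolding curve_def image_image
proof (rule image_cong[OF refl])
  fix w assume "w \<in> S1"
  then have w: "norm w = 1" "w \<noteq> 0" by auto
  have sgn_w: "sgn (2 * w powi m) = w powi m"
    using w by (simp add: sgn_div_norm norm_mult norm_power_int scaleR_conv_of_real)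
  have "cnj w = inverse w"
    using w(1) by (rule cnj_unit)
  then have "w * cnj (w powi m) = w powi (1 - m)"
    using w(2) by (simp add: power_int_diff power_int_inverse divide_inverse)
  then show "untwist (sgn (2 * w powi m, w)) = sgn (2 * w powi m, w powi (1 - m))"
    using w by (simp add: untwist_sgn) (simp add: untwist_def sgn_w)
qed

lemma blow_down_graph_link:
  fixes m :: int and \<rho> \<gamma> :: "complex \<Rightarrow> real"
  assumes "continuous_on S1 \<rho>" "continuous_on S1 \<gamma>"
    and "\<And>w. w \<in> S1 \<Longrightarrow> \<rho> w > 0"
    and "\<And>w. w \<in> S1 \<Longrightarrow> f w = \<rho> w *\<^sub>R (w powi m * cis (\<gamma> w))"
    and J: "isotopic (curve (\<lambda>w. (2 * w powi m, w powi (1 - m)))) J"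
  shows "J \<in> blow_down 1 (curve (\<lambda>w. (w, f w))) (curve (\<lambda>w. (w, - f w)))"
proof -
  obtain F where F: "isotopic_to_id F" "F ` unknot = curve (\<lambda>w. (w, f w))"
    "F ` curve (\<lambda>w. (2 * w powi m, w)) = curve (\<lambda>w. (w, - f w))"
    using straighten_graph_link[OF assms(1-4)] by blast
  have "J \<in> blow_down 1 (F ` unknot) (F ` curve (\<lambda>w. (2 * w powi m, w)))"
  proof (rule blow_down_plus_one[OF F(1)])
    show "isotopic (untwist ` curve (\<lambda>w. (2 * w powi m, w))) J"
      using J by (simp add: untwist_curve)
    show "curve (\<lambda>w. (2 * w powi m, w)) \<subseteq> {x \<in> S3. norm (snd x) < norm (fst x)}"
    proof
      fix x assume "x \<in> curve (\<lambda>w. (2 * w powi m, w))"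
      then obtain w where w: "norm w = 1" and x: "x = sgn (2 * w powi m, w)"
        by (auto simp: curve_def)
      have nz: "(2 * w powi m, w) \<noteq> 0" using w by (auto simp: zero_prod_def)
      then have "x \<in> S3" unfolding x by (rule sgn_in_S3)
      moreover have "norm (snd x) < norm (fst x)"
        using w nz unfolding x by (simp add: sgn_Pair norm_mult norm_power_int)
      ultimately show "x \<in> {x \<in> S3. norm (snd x) < norm (fst x)}" by simp
    qed
  qed
  then show ?thesis by (simp add: F)
qed

section \<open>The resulting torus knots\<close>

lemma isotopic_image: "isotopic_to_id F \<Longrightarrow> F ` K = J \<Longrightarrow> isotopic K J"
  unfolding isotopic_def by blast

text \<open>
  The pairs \<open>(2w\<^sup>m, w\<^sup>k)\<close> and \<open>(w\<^sup>m, w\<^sup>k / 2)\<close> project to the same point of \<open>S\<^sup>3\<close>.  The second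
  has its first coordinate on the unit circle, where it can be halved; this gives both
  coordinates the same modulus.
\<close>

lemma isotopic_shrink:
  "isotopic (curve (\<lambda>w. (2 * w powi m, w powi k))) (curve (\<lambda>w. (w powi m, w powi k)))"
proof -
  obtain F where F: "isotopic_to_id F"
      "\<And>a b. norm a = 1 \<Longrightarrow> F (sgn (a, b)) = sgn ((1/2) *\<^sub>R a, b)"
    by (rule scaling_curve[of "\<lambda>_. 1/2"]) auto
  have "F (sgn (2 * w powi m, w powi k)) = sgn (w powi m, w powi k)" if "norm w = 1" for w
  proof -
    have "(2 * w powi m, w powi k) = 2 *\<^sub>R (w powi m, (1/2) *\<^sub>R w powi k)"
      by (simp add: scaleR_conv_of_real)
    then have "F (sgn (2 * w powi m, w powi k)) = F (sgn (w powi m, (1/2) *\<^sub>R w powi k))"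
      by (simp add: sgn_scaleR del: scaleR_Pair)
    also have "\<dots> = sgn ((1/2) *\<^sub>R (w powi m, w powi k))"
      using that by (simp add: F(2) norm_power_int)
    also have "\<dots> = sgn (w powi m, w powi k)"
      by (simp add: sgn_scaleR del: scaleR_Pair)
    finally show ?thesis .
  qed
  then have "F ` curve (\<lambda>w. (2 * w powi m, w powi k)) = curve (\<lambda>w. (w powi m, w powi k))"
    unfolding curve_def image_image by (intro image_cong) auto
  then show ?thesis using F(1) isotopic_image by blast
qed

text \<open>
  Exchanging the coordinates is a unitary map, hence preserves orientation; a quarter turn followed
  by a half turn of the second coordinate is the exchange.
\<close>

lemma isotopic_swap:
  "isotopic (curve (\<lambda>w. (a w, b w))) (curve (\<lambda>w. (b w, a w)))"
proof -
  have "isotopic_to_id (\<lambda>x. (\<lambda>x. (fst x, - snd x)) ((\<lambda>(a, b). (b, - a)) x))"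
    by (rule isotopic_to_id_comp[OF isotopic_to_id_rotation isotopic_to_id_negate_snd])
  then have "isotopic_to_id (\<lambda>(a, b). (b, a))"
    by (simp add: case_prod_unfold)
  moreover have "(\<lambda>(a, b). (b, a)) ` curve (\<lambda>w. (a w, b w)) = curve (\<lambda>w. (b w, a w))"
    unfolding curve_def image_image by (simp add: sgn_Pair norm_Pair add.commute)
  ultimately show ?thesis by (rule isotopic_image)
qed

lemma mirror_torus_knot: "mirror (torus_knot p q) = curve (\<lambda>w. (w ^ p, cnj w ^ q))"
  unfolding mirror_def torus_knot_def curve_def image_image
  by (simp add: sgn_Pair norm_Pair norm_power)

lemma curve_cnj: "curve (\<lambda>w. c (cnj w)) = curve c"
proof -
  have "cnj ` S1 = S1"
    by (rule antisym) (auto intro!: image_eqI[of _ cnj "cnj _"])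
  then have "curve c = (\<lambda>w. sgn (c w)) ` cnj ` S1" by (simp add: curve_def)
  then show ?thesis by (simp add: curve_def image_image)
qed

lemma isotopic_positive:
  assumes "n > 0"
  shows "isotopic (curve (\<lambda>w. (2 * w powi int n, w powi (1 - int n)))) (mirror (torus_knot (n - 1) n))"
proof -
  have "curve (\<lambda>w. (w powi (1 - int n), w powi int n)) = curve (\<lambda>w. (cnj w ^ (n - 1), w ^ n))"
  proof (rule curve_cong)
    fix w :: complex assume w: "norm w = 1"
    have "1 - int n = - int (n - 1)" using assms by simp
    then have "w powi (1 - int n) = cnj w ^ (n - 1)"
      using w by (simp only: power_int_minus cnj_unit power_int_of_nat power_inverse)
    then show "sgn (w powi (1 - int n), w powi int n) = sgn (cnj w ^ (n - 1), w ^ n)" by simp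
  qed
  also have "\<dots> = curve (\<lambda>w. (w ^ (n - 1), cnj w ^ n))"
    using curve_cnj[of "\<lambda>w. (w ^ (n - 1), cnj w ^ n)"] by simp
  finally show ?thesis
    using isotopic_trans[OF isotopic_shrink isotopic_swap] by (metis mirror_torus_knot)
qed

lemma isotopic_negative:
  "isotopic (curve (\<lambda>w. (2 * w powi (- int n), w powi (1 + int n)))) (mirror (torus_knot n (n + 1)))"
proof -
  have "curve (\<lambda>w. (w powi (- int n), w powi (1 + int n))) = curve (\<lambda>w. (cnj w ^ n, w ^ (n + 1)))"
  proof (rule curve_cong)
    fix w :: complex assume w: "norm w = 1"
    have "w powi (- int n) = cnj w ^ n"
      using w by (simp only: power_int_minus cnj_unit power_int_of_nat power_inverse)
    moreover have "1 + int n = int (n + 1)" by simp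
    then have "w powi (1 + int n) = w ^ (n + 1)" by (simp only: power_int_of_nat)
    ultimately show "sgn (w powi (- int n), w powi (1 + int n)) = sgn (cnj w ^ n, w ^ (n + 1))" by simp
  qed
  also have "\<dots> = curve (\<lambda>w. (w ^ n, cnj w ^ (n + 1)))"
    using curve_cnj[of "\<lambda>w. (w ^ n, cnj w ^ (n + 1))"] by simp
  finally show ?thesis
    using isotopic_shrink by (metis mirror_torus_knot)
qed

lemma isotopic_zero: "isotopic (curve (\<lambda>w. (2, w))) unknot"
proof -
  obtain S where S: "isotopic_to_id S" "\<And>a b. norm a = 1 \<Longrightarrow> S (sgn (a, b)) = sgn (a, b - 2)"
    by (rule shear_curve[of "\<lambda>_. - 2"]) auto
  have "isotopic (curve (\<lambda>w. (w, 2))) (curve (\<lambda>w. (w, 0)))"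
  proof (rule isotopic_image[OF S(1)])
    show "S ` curve (\<lambda>w. (w, 2)) = curve (\<lambda>w. (w, 0))"
      unfolding curve_def image_image by (intro image_cong) (auto simp: S)
  qed
  then have "isotopic (curve (\<lambda>w. (2, w))) (curve (\<lambda>w. (0, w)))"
    using isotopic_swap[of "\<lambda>_. 2" "\<lambda>w. w"] isotopic_swap[of "\<lambda>w. w" "\<lambda>_. 0"]
    by (blast intro: isotopic_trans)
  then show ?thesis by (simp add: unknot_eq_curve)
qed

section \<open>Integral two-bridge links\<close>

text \<open>
  The tangle arcs and the closing arcs both run through first coordinates with imaginary part
  \<open>cos (\<pi>x)\<close>, so the parameter \<open>\<pi>x\<close> is recovered by the arccosine on either half of the circle.
\<close>

definition height_angle :: "complex \<Rightarrow> real" where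
  "height_angle w = arccos (Im w)"

text \<open>
  The function whose graph is the upper component of \<open>N(2m/1)\<close>: the rational tangle lies over the
  right half of the circle and the closing arc over the left half.
\<close>

definition strand :: "int \<Rightarrow> complex \<Rightarrow> complex" where
  "strand m w =
     (if Re w \<ge> 0 then Complex (cos (of_int (2 * m) * height_angle w)) (- Re w * sin (of_int (2 * m) * height_angle w))
      else 1)"

lemma unit_right: "norm w = 1 \<Longrightarrow> Re w \<ge> 0 \<Longrightarrow> w = Complex (sin (height_angle w)) (cos (height_angle w))"
  and unit_left: "norm w = 1 \<Longrightarrow> Re w \<le> 0 \<Longrightarrow> w = Complex (- sin (height_angle w)) (cos (height_angle w))"
proof -
  assume w: "norm w = 1"
  then have Im: "- 1 \<le> Im w" "Im w \<le> 1" using abs_Im_le_cmod[of w] by linarith+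
  have "(Re w)\<^sup>2 = 1 - (Im w)\<^sup>2" using w cmod_power2[of w] by simp
  then have sin: "sin (height_angle w) = \<bar>Re w\<bar>"
    unfolding height_angle_def using Im by (subst sin_arccos) (auto simp flip: real_sqrt_abs)
  have cos: "cos (height_angle w) = Im w"
    unfolding height_angle_def using Im by simp
  show "Re w \<ge> 0 \<Longrightarrow> w = Complex (sin (height_angle w)) (cos (height_angle w))"
       "Re w \<le> 0 \<Longrightarrow> w = Complex (- sin (height_angle w)) (cos (height_angle w))"
    by (simp_all add: sin cos complex_eq_iff)
qed

lemma height_angle_bounds: "norm w = 1 \<Longrightarrow> 0 \<le> height_angle w" "norm w = 1 \<Longrightarrow> height_angle w \<le> pi"
  unfolding height_angle_def using abs_Im_le_cmod[of w] by (auto intro!: arccos_lbound arccos_ubound)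

lemma height_angle_Complex: "0 \<le> x \<Longrightarrow> x \<le> 1 \<Longrightarrow> height_angle (Complex a (cos (pi * x))) = pi * x"
  unfolding height_angle_def by (simp add: arccos_cos mult_left_le)

lemma sin_cos_two_int_pi: "sin (of_int (2 * m) * pi) = 0" "cos (of_int (2 * m) * pi) = 1"
  using sin_int_2pin[of m] cos_int_2pin[of m] by (simp_all add: mult_ac)

text \<open>
  Over \<open>\<plusminus>\<i>\<close>, where the two halves of the circle meet, the formula for the tangle arc also has the
  value \<open>1\<close>, because there \<open>2m\<close> times the height angle is a multiple of \<open>2\<pi>\<close>.
\<close>

lemma strand_left:
  assumes "norm w = 1" "Re w \<le> 0"
  shows "strand m w = 1"
proof (cases "Re w = 0")
  case True
  then have "Im w = 1 \<or> Im w = - 1"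
    using assms cmod_power2[of w] by (simp add: power2_eq_1_iff)
  then have "height_angle w = 0 \<or> height_angle w = pi"
    unfolding height_angle_def by (auto simp: arccos_1 arccos_minus_1)
  then show ?thesis
    using True sin_cos_two_int_pi[of m] by (auto simp: strand_def complex_eq_iff)
qed (use assms in \<open>simp add: strand_def\<close>)

lemma right_half: "(\<lambda>x. Complex (sin (pi * x)) (cos (pi * x))) ` {0..1} = {w. norm w = 1 \<and> Re w \<ge> 0}"
  and left_half: "(\<lambda>x. Complex (- sin (pi * x)) (cos (pi * x))) ` {0..1} = {w. norm w = 1 \<and> Re w \<le> 0}"
proof -
  have sin: "sin (pi * x) \<ge> 0" if "x \<in> {0..1}" for x
    using that by (intro sin_ge_zero) (auto simp: mult_left_le)
  have X: "height_angle w / pi \<in> {0..1}" if "norm w = 1" for w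
    using height_angle_bounds[OF that] by simp
  show "(\<lambda>x. Complex (sin (pi * x)) (cos (pi * x))) ` {0..1} = {w. norm w = 1 \<and> Re w \<ge> 0}"
  proof (intro equalityI subsetI)
    fix w assume "w \<in> {w. norm w = 1 \<and> Re w \<ge> 0}"
    then show "w \<in> (\<lambda>x. Complex (sin (pi * x)) (cos (pi * x))) ` {0..1}"
      using unit_right[of w] X[of w] by (intro image_eqI[of _ _ "height_angle w / pi"]) auto
  qed (use sin in \<open>auto simp: cmod_def\<close>)
  show "(\<lambda>x. Complex (- sin (pi * x)) (cos (pi * x))) ` {0..1} = {w. norm w = 1 \<and> Re w \<le> 0}"
  proof (intro equalityI subsetI)
    fix w assume "w \<in> {w. norm w = 1 \<and> Re w \<le> 0}"
    then show "w \<in> (\<lambda>x. Complex (- sin (pi * x)) (cos (pi * x))) ` {0..1}"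
      using unit_left[of w] X[of w] by (intro image_eqI[of _ _ "height_angle w / pi"]) auto
  qed (use sin in \<open>auto simp: cmod_def\<close>)
qed

text \<open>
  Shifting the tangle arc by \<open>c = 0\<close> or \<open>c = 1\<close> multiplies its second coordinate by \<open>d = 1\<close> or
  \<open>d = -1\<close>.
\<close>

lemma integral_component:
  fixes c d :: real
  assumes "cos (pi * c) = d" "sin (pi * c) = 0"
  shows "tangle_arc (2 * m) 1 c \<union> closing_arc (of_real d) = curve (\<lambda>w. (w, of_real d * strand m w))"
proof -
  let ?g = "\<lambda>w. sgn (w, of_real d * strand m w)"
  have "tangle_arc (2 * m) 1 c = ?g ` (\<lambda>x. Complex (sin (pi * x)) (cos (pi * x))) ` {0..1}"
    unfolding tangle_arc_def image_image
  proof (rule image_cong[OF refl])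
    fix x :: real assume x: "x \<in> {0..1}"
    have "sin (pi * x) \<ge> 0"
      using x by (intro sin_ge_zero) (auto simp: mult_left_le)
    then have strand: "strand m (Complex (sin (pi * x)) (cos (pi * x))) =
        Complex (cos (of_int (2 * m) * (pi * x))) (- sin (pi * x) * sin (of_int (2 * m) * (pi * x)))"
      using x by (simp add: strand_def height_angle_Complex)
    have "pi * (of_int (2 * m) * x + c) = of_int (2 * m) * (pi * x) + pi * c"
      by (simp add: algebra_simps)
    then have "cos (pi * (of_int (2 * m) * x + c)) = d * cos (of_int (2 * m) * (pi * x))"
         "sin (pi * (of_int (2 * m) * x + c)) = d * sin (of_int (2 * m) * (pi * x))"
      using assms by (simp_all only: cos_add sin_add) simp_all
    then show "(let s = of_int 1 * x; t = of_int (2 * m) * x + c in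
        sgn (Complex (sin (pi * x)) (cos (pi * s)), Complex (cos (pi * t)) (- sin (pi * s) * sin (pi * t)))) =
      ?g (Complex (sin (pi * x)) (cos (pi * x)))"
      unfolding strand Let_def by (simp add: complex_of_real_mult_Complex mult_ac)
  qed
  moreover have "closing_arc (of_real d) = ?g ` (\<lambda>x. Complex (- sin (pi * x)) (cos (pi * x))) ` {0..1}"
    unfolding closing_arc_def image_image
  proof (rule image_cong[OF refl])
    fix x :: real assume "x \<in> {0..1}"
    then have "Complex (- sin (pi * x)) (cos (pi * x)) \<in> {w. norm w = 1 \<and> Re w \<le> 0}"
      unfolding left_half[symmetric] by blast
    then show "sgn (Complex (- sin (pi * x)) (cos (pi * x)), of_real d) = ?g (Complex (- sin (pi * x)) (cos (pi * x)))"
      using strand_left by simp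
  qed
  moreover have "{w. norm w = 1 \<and> Re w \<ge> 0} \<union> {w. norm w = 1 \<and> Re w \<le> 0} = S1"
    by auto
  ultimately show ?thesis
    unfolding right_half left_half curve_def by (simp only: image_Un[symmetric])
qed

lemma upper_component_integral: "upper_component (of_int (2 * m)) = curve (\<lambda>w. (w, strand m w))"
  and lower_component_integral: "lower_component (of_int (2 * m)) = curve (\<lambda>w. (w, - strand m w))"
  unfolding upper_component_def lower_component_def quotient_of_rat_of_int
  using integral_component[of 0 1 m] integral_component[of 1 "- 1" m] by simp_all

lemma continuous_on_height_angle: "continuous_on S1 height_angle"
  unfolding height_angle_def
proof (intro continuous_intros ballI conjI)
  fix w assume "w \<in> S1"
  then show "- 1 \<le> Im w" "Im w \<le> 1" using abs_Im_le_cmod[of w] by auto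
qed

lemma continuous_on_strand: "continuous_on S1 (strand m)"
proof -
  define R L where "R = S1 \<inter> {w. Re w \<ge> 0}" and "L = S1 \<inter> {w. Re w \<le> 0}"
  let ?T = "\<lambda>w. Complex (cos (of_int (2 * m) * height_angle w)) (- Re w * sin (of_int (2 * m) * height_angle w))"
  have "closed R" "closed L"
    unfolding R_def L_def by (auto intro!: closed_Int closed_Collect_le continuous_intros)
  moreover have "continuous_on R height_angle"
    by (rule continuous_on_subset[OF continuous_on_height_angle]) (auto simp: R_def)
  then have "continuous_on R ?T"
    by (intro continuous_on_Complex continuous_intros)
  moreover have "continuous_on L (\<lambda>_. 1)" by simp
  moreover have "\<forall>w. w \<in> R \<and> \<not> 0 \<le> Re w \<or> w \<in> L \<and> 0 \<le> Re w \<longrightarrow> ?T w = 1"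
  proof (intro allI impI)
    fix w assume "w \<in> R \<and> \<not> 0 \<le> Re w \<or> w \<in> L \<and> 0 \<le> Re w"
    then show "?T w = 1" using strand_left[of w m] by (auto simp: R_def L_def strand_def)
  qed
  ultimately have "continuous_on (R \<union> L) (\<lambda>w. if 0 \<le> Re w then ?T w else 1)"
    by (rule continuous_on_cases)
  moreover have "R \<union> L = S1" by (auto simp: R_def L_def)
  ultimately show ?thesis by (simp add: strand_def[abs_def])
qed

text \<open>
  The factor \<open>w\<^bsup>-m\<^esup> cis (m (\<pi>/2 + X))\<close>, with \<open>X\<close> the height angle, is \<open>1\<close> over the left half and
  \<open>cis (2mX)\<close> over the right half of the circle.  It so rotates the elliptical strand back to within
  a right angle of the positive real axis, which shows that the strand is \<open>w\<^sup>m\<close> up to a positive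
  factor and a continuous real phase.
\<close>

lemma strand_winding:
  assumes "norm w = 1"
  shows "Re (strand m w * w powi (- m) * cis (of_int m * (pi / 2 + height_angle w))) > 0"
proof -
  define X where "X = height_angle w"
  show ?thesis
  proof (cases "Re w \<ge> 0")
    case True
    define \<tau> where "\<tau> = of_int (2 * m) * X"
    have wX: "w = Complex (sin X) (cos X)" using unit_right[OF assms True] by (simp add: X_def)
    then have Re_w: "Re w = sin X" by (metis complex.sel(1))
    have strand_eq: "strand m w = Complex (cos \<tau>) (- sin X * sin \<tau>)"
      using True Re_w unfolding strand_def X_def[symmetric] \<tau>_def[symmetric] by simp
    have "w = cis (pi / 2 - X)" using wX by (simp add: complex_eq_iff cos_diff sin_diff)
    then have "w powi (- m) * cis (of_int m * (pi / 2 + X)) = cis \<tau>"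
      by (simp add: cis_power_int cis_mult \<tau>_def algebra_simps)
    then have "strand m w * w powi (- m) * cis (of_int m * (pi / 2 + X)) = strand m w * cis \<tau>"
      by (simp only: mult.assoc)
    also have "Re \<dots> = (cos \<tau>)\<^sup>2 + sin X * (sin \<tau>)\<^sup>2"
      by (simp add: strand_eq power2_eq_square)
    also have "\<dots> > 0"
    \<comment> \<open>The cosine does not vanish at the ends of the half circle, and elsewhere \<open>sin X\<close> is positive.\<close>
    proof (cases "cos \<tau> = 0")
      case False
      moreover have "sin X \<ge> 0" using True Re_w by simp
      ultimately show ?thesis by (simp add: add_pos_nonneg)
    next
      case True
      then have "(sin \<tau>)\<^sup>2 = 1" using sin_cos_squared_add[of \<tau>] by simp
      moreover have "sin X > 0"
      proof (rule ccontr)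
        assume "\<not> sin X > 0"
        then have "Re w \<le> 0" using Re_w by simp
        then have "strand m w = 1" using strand_left assms by blast
        then have "cos \<tau> = 1" using \<open>Re w \<ge> 0\<close> by (auto simp: strand_def X_def[symmetric] \<tau>_def complex_eq_iff)
        then show False using True by simp
      qed
      ultimately show ?thesis using True by simp
    qed
    finally show ?thesis by (simp add: X_def)
  next
    case False
    then have wX: "w = Complex (- sin X) (cos X)" using unit_left[OF assms] by (simp add: X_def)
    then have "w = cis (pi / 2 + X)" by (simp add: complex_eq_iff cos_add sin_add)
    then have "w powi (- m) * cis (of_int m * (pi / 2 + X)) = 1"
      by (simp add: cis_power_int cis_mult)
    then have "strand m w * w powi (- m) * cis (of_int m * (pi / 2 + X)) = 1"
      using strand_left[OF assms] False by (simp only: mult.assoc) simp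
    then show ?thesis by (simp add: X_def)
  qed
qed

text \<open>
  The function \<open>k\<close> in the proof is the strand with its winding removed.  Its values have positive
  real part, so the principal argument is continuous along it and gives the phase that
  \<open>blow_down_graph_link\<close> asks for.
\<close>

lemma K_plus_integral:
  assumes J: "isotopic (curve (\<lambda>w. (2 * w powi m, w powi (1 - m)))) J"
  shows "J \<in> K_plus (of_int (2 * m))"
proof -
  define \<beta> where "\<beta> w = of_int m * (pi / 2 + height_angle w)" for w
  define k where "k w = strand m w * w powi (- m) * cis (\<beta> w)" for w
  have Re_k: "Re (k w) > 0" if "w \<in> S1" for w
    using strand_winding[of w m] that by (simp add: k_def \<beta>_def)
  have nonpos: "k w \<notin> \<real>\<^sub>\<le>\<^sub>0" if "w \<in> S1" for w
    using Re_k[OF that] by (auto simp: complex_nonpos_Reals_iff)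
  have cont_\<beta>: "continuous_on S1 \<beta>"
    unfolding \<beta>_def by (intro continuous_intros continuous_on_height_angle)
  have cont_k: "continuous_on S1 k"
    unfolding k_def by (intro continuous_intros continuous_on_strand cont_\<beta>) auto
  have "J \<in> blow_down 1 (curve (\<lambda>w. (w, strand m w))) (curve (\<lambda>w. (w, - strand m w)))"
  proof (rule blow_down_graph_link[OF _ _ _ _ J])
    show "continuous_on S1 (\<lambda>w. norm (k w))"
      by (intro continuous_intros cont_k)
    show "continuous_on S1 (\<lambda>w. Arg (k w) - \<beta> w)"
      by (intro continuous_intros cont_k cont_\<beta> nonpos) simp
    show "norm (k w) > 0" if "w \<in> S1" for w
      using Re_k[OF that] by auto
    show "strand m w = norm (k w) *\<^sub>R (w powi m * cis (Arg (k w) - \<beta> w))" if "w \<in> S1" for w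
    proof -
      have nz: "w \<noteq> 0" using that by auto
      have "norm (k w) *\<^sub>R cis (Arg (k w)) = k w"
        using rcis_cmod_Arg[of "k w"] by (simp add: rcis_def scaleR_conv_of_real)
      then have "norm (k w) *\<^sub>R (w powi m * cis (Arg (k w) - \<beta> w)) = k w * cis (- \<beta> w) * w powi m"
        by (simp add: cis_mult[symmetric] scaleR_conv_of_real mult_ac flip: uminus_add_conv_diff)
      also have "\<dots> = strand m w * (w powi (- m) * w powi m) * (cis (\<beta> w) * cis (- \<beta> w))"
        by (simp add: k_def mult_ac)
      also have "\<dots> = strand m w"
        using nz by (simp add: cis_mult power_int_minus)
      finally show ?thesis by simp
    qed
  qed
  then show ?thesis
    unfolding K_plus_def upper_component_integral lower_component_integral .
qed

theorem proposition4p1: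
  shows "(\<forall>n::nat. n > 0 \<longrightarrow>
            mirror (torus_knot (n - 1) n) \<in> K_plus (of_int (2 * int n)) \<and>
            mirror (torus_knot n (n + 1)) \<in> K_plus (of_int (- 2 * int n))) \<and>
         unknot \<in> K_plus 0"
proof (intro conjI allI impI)
  fix n :: nat
  assume "n > 0"
  then show "mirror (torus_knot (n - 1) n) \<in> K_plus (of_int (2 * int n))"
    by (intro K_plus_integral isotopic_positive)
  show "mirror (torus_knot n (n + 1)) \<in> K_plus (of_int (- 2 * int n))"
    using K_plus_integral[of "- int n"] isotopic_negative[of n] by simp
next
  show "unknot \<in> K_plus 0"
    using K_plus_integral[of 0 unknot] isotopic_zero by simp
qed

end
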